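(* Let $\Bbbk$ be a field and $N\ge3$. For any number $0\le m\le N-1$ there is a unital embedding (injective homomorphism) of $\Bbbk$-algebras $\varepsilon_m:\mathrm{n}\widehat{\mathrm{TL}}_N\to\mathrm{n}\widehat{\mathrm{TL}}_{N+1}$ given by $$a_i\mapsto\begin{cases}a_i&\text{for }0\le i\le m-1,\\ a_{m+1}a_m&\text{for }i=m,\\ a_{i+1}&\text{for }m+1\le i\le N-1.\end{cases}$$
   Context: For $M\ge3$, the affine nilTemperley-Lieb algebra $\mathrm{n}\widehat{\mathrm{TL}}_M$ is the unital associative $\Bbbk$-algebra with generators $a_0,\dots,a_{M-1}$ and relations $a_i^2=0$, $a_ia_j=a_ja_i$ for $i-j\not\equiv\pm1 \pmod M$, and $a_ia_{i+1}a_i=a_{i+1}a_ia_{i+1}=0$ for all $i$, all indices modulo $M$. In the claim, symbols $a_i$ on the left of $\mapsto$ are generators of $\mathrm{n}\widehat{\mathrm{TL}}_N$ and those on the right are generators of $\mathrm{n}\widehat{\mathrm{TL}}_{N+1}$. *)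

theory Defs
  imports
    "HOL-Library.Poly_Mapping"
    "HOL-Algebra.QuotRing"
    "HOL-Algebra.Module"
    "HOL-Number_Theory.Cong"
begin

text \<open>
  Words in letters indexed by natural numbers, under concatenation. The monoid is written additively
  (\<open>0\<close> is the empty word, \<open>+\<close> is concatenation and is not commutative) because the convolution
  product of \<^theory>\<open>HOL-Library.Poly_Mapping\<close> is set up for additive monoids of exponents. With
  this, the ring structure on finitely supported functions from words to \<open>'k\<close> is that of the free
  associative unital algebra.
\<close>

datatype gen_word = Word (letters: "nat list")

instantiation gen_word :: monoid_add
begin

definition zero_gen_word :: gen_word
  where "0 = Word []"

definition plus_gen_word :: "gen_word \<Rightarrow> gen_word \<Rightarrow> gen_word"
  where "u + v = Word (letters u @ letters v)"

instance
  by standard (simp_all add: zero_gen_word_def plus_gen_word_def)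

end

lemma letters_zero [simp]: "letters 0 = []"
  by (simp add: zero_gen_word_def)

lemma letters_plus [simp]: "letters (u + v) = letters u @ letters v"
  by (simp add: plus_gen_word_def)

text \<open>
  Associative unital, not necessarily commutative, algebras over a field \<open>'k\<close>. The library locale
  \<^locale>\<open>algebra\<close> requires commutativity, so only the record type of
  \<^theory>\<open>HOL-Algebra.Module\<close> is reused.
\<close>

locale assoc_algebra = ring A for A :: "('k::field, 'a, 'm) module_scheme" (structure) +
  assumes smult_closed: "x \<in> carrier A \<Longrightarrow> c \<odot> x \<in> carrier A"
    and smult_l_distr: "x \<in> carrier A \<Longrightarrow> (c + d) \<odot> x = c \<odot> x \<oplus> d \<odot> x"
    and smult_r_distr: "\<lbrakk>x \<in> carrier A; y \<in> carrier A\<rbrakk> \<Longrightarrow> c \<odot> (x \<oplus> y) = c \<odot> x \<oplus> c \<odot> y"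
    and smult_assoc1: "x \<in> carrier A \<Longrightarrow> (c * d) \<odot> x = c \<odot> (d \<odot> x)"
    and smult_one: "x \<in> carrier A \<Longrightarrow> 1 \<odot> x = x"
    and smult_mult_l: "\<lbrakk>x \<in> carrier A; y \<in> carrier A\<rbrakk> \<Longrightarrow> (c \<odot> x) \<otimes> y = c \<odot> (x \<otimes> y)"
    and smult_mult_r: "\<lbrakk>x \<in> carrier A; y \<in> carrier A\<rbrakk> \<Longrightarrow> x \<otimes> (c \<odot> y) = c \<odot> (x \<otimes> y)"

text \<open>Elements of \<^const>\<open>ring_hom\<close> preserve the unit, so these are the unital homomorphisms.\<close>

definition alg_hom ::
    "('k, 'a, 'm) module_scheme \<Rightarrow> ('k, 'b, 'n) module_scheme \<Rightarrow> ('a \<Rightarrow> 'b) set"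
  where "alg_hom A B =
    {h \<in> ring_hom A B. \<forall>c. \<forall>x\<in>carrier A. h (c \<odot>\<^bsub>A\<^esub> x) = c \<odot>\<^bsub>B\<^esub> h x}"

definition free_alg :: "nat \<Rightarrow> ('k::field, gen_word \<Rightarrow>\<^sub>0 'k) module"
  where "free_alg M =
    \<lparr>carrier = {p. \<forall>w\<in>Poly_Mapping.keys p. set (letters w) \<subseteq> {..<M}},
     monoid.mult = (*), one = 1, zero = 0, add = (+),
     smult = (\<lambda>c p. Poly_Mapping.single 0 c * p)\<rparr>"

definition fvar :: "nat \<Rightarrow> (gen_word \<Rightarrow>\<^sub>0 'k::field)"
  where "fvar i = Poly_Mapping.single (Word [i]) 1"

text \<open>The ring quotient by a two-sided ideal, with the scalar multiplication induced on cosets.\<close>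

definition quot_alg ::
    "('k, 'a, 'm) module_scheme \<Rightarrow> 'a set \<Rightarrow> ('k, 'a set) module"
  where "quot_alg A I =
    ring.extend (A Quot I) (module.fields (\<lambda>c X. \<Union>x\<in>X. I +>\<^bsub>A\<^esub> (c \<odot>\<^bsub>A\<^esub> x)))"

text \<open>A relation \<open>u = v\<close> is encoded as the element \<open>u - v\<close> of the free algebra.\<close>

definition nTL_rels :: "nat \<Rightarrow> (gen_word \<Rightarrow>\<^sub>0 'k::field) set"
  where "nTL_rels M =
    {fvar i * fvar i | i. i < M} \<union>
    {fvar i * fvar j - fvar j * fvar i | i j. i < M \<and> j < M \<and>
       \<not> [int i - int j = 1] (mod int M) \<and> \<not> [int i - int j = - 1] (mod int M)} \<union>
    {fvar i * fvar ((i + 1) mod M) * fvar i | i. i < M} \<union>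
    {fvar ((i + 1) mod M) * fvar i * fvar ((i + 1) mod M) | i. i < M}"

definition nTL_ideal :: "nat \<Rightarrow> (gen_word \<Rightarrow>\<^sub>0 'k::field) set"
  where "nTL_ideal M = genideal (free_alg M) (nTL_rels M)"

definition nTL :: "nat \<Rightarrow> ('k::field, (gen_word \<Rightarrow>\<^sub>0 'k) set) module"
  where "nTL M = quot_alg (free_alg M) (nTL_ideal M)"

definition nTL_gen :: "nat \<Rightarrow> nat \<Rightarrow> (gen_word \<Rightarrow>\<^sub>0 'k::field) set"
  where "nTL_gen M i = nTL_ideal M +>\<^bsub>free_alg M\<^esub> fvar i"

lemma fvar_in_free_alg: "i < M \<Longrightarrow> fvar i \<in> carrier (free_alg M)"
  by (simp add: free_alg_def fvar_def)

lemma free_alg_mult_closed: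
  fixes p q :: "gen_word \<Rightarrow>\<^sub>0 'k::field"
  assumes "p \<in> carrier (free_alg M)" "q \<in> carrier (free_alg M)"
  shows "p * q \<in> carrier (free_alg M)"
proof -
  have "set (letters w) \<subseteq> {..<M}" if w: "w \<in> Poly_Mapping.keys (p * q)" for w
  proof -
    obtain u v where "w = u + v" "u \<in> Poly_Mapping.keys p" "v \<in> Poly_Mapping.keys q"
      using w keys_mult[of p q] by blast
    then show ?thesis
      using assms by (auto simp: free_alg_def)
  qed
  then show ?thesis
    by (simp add: free_alg_def)
qed

lemma free_alg_add_closed:
  "\<lbrakk>p \<in> carrier (free_alg M); q \<in> carrier (free_alg M)\<rbrakk> \<Longrightarrow> p + q \<in> carrier (free_alg M)"
  using Poly_Mapping.keys_add[of p q] by (fastforce simp: free_alg_def)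

lemma free_alg_uminus_closed:
  "p \<in> carrier (free_alg M) \<Longrightarrow> - p \<in> carrier (free_alg M)"
  by (simp add: free_alg_def)

lemma free_alg_const_closed: "Poly_Mapping.single 0 c \<in> carrier (free_alg M)"
  by (simp add: free_alg_def)

lemma single_zero_commute:
  fixes p :: "gen_word \<Rightarrow>\<^sub>0 'k::field"
  shows "p * Poly_Mapping.single 0 c = Poly_Mapping.single 0 c * p"
proof (induction p rule: update_induct)
  case const
  show ?case by simp
next
  case (update p w d)
  have "Poly_Mapping.update w d p = p + Poly_Mapping.single w d"
    using update.hyps(1)
    by (intro poly_mapping_eqI)
      (auto simp: lookup_update lookup_add lookup_single in_keys_iff when_def)
  with update.IH show ?case
    by (simp add: distrib_left distrib_right mult_single mult.commute)
qed

lemma ring_free_alg: "ring (free_alg M :: ('k::field, gen_word \<Rightarrow>\<^sub>0 'k) module)"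
proof (rule ringI)
  show "abelian_group (free_alg M :: ('k, gen_word \<Rightarrow>\<^sub>0 'k) module)"
  proof (rule abelian_groupI)
    show "\<exists>y\<in>carrier (free_alg M). y \<oplus>\<^bsub>free_alg M\<^esub> x = \<zero>\<^bsub>free_alg M\<^esub>"
      if "x \<in> carrier (free_alg M)" for x :: "gen_word \<Rightarrow>\<^sub>0 'k"
      using free_alg_uminus_closed[OF that] by (intro bexI[of _ "- x"]) (simp_all add: free_alg_def)
  next
    show "x \<oplus>\<^bsub>free_alg M\<^esub> y \<in> carrier (free_alg M)"
      if "x \<in> carrier (free_alg M)" "y \<in> carrier (free_alg M)" for x y :: "gen_word \<Rightarrow>\<^sub>0 'k"
      using free_alg_add_closed[OF that] by (simp add: free_alg_def)
  qed (simp_all add: free_alg_def ac_simps)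
  show "monoid (free_alg M :: ('k, gen_word \<Rightarrow>\<^sub>0 'k) module)"
  proof (rule monoidI)
    show "x \<otimes>\<^bsub>free_alg M\<^esub> y \<in> carrier (free_alg M)"
      if "x \<in> carrier (free_alg M)" "y \<in> carrier (free_alg M)" for x y :: "gen_word \<Rightarrow>\<^sub>0 'k"
      using free_alg_mult_closed[OF that] by (simp add: free_alg_def)
  qed (simp_all add: free_alg_def mult.assoc)
qed (auto simp: free_alg_def distrib_left distrib_right)

lemma assoc_algebra_free_alg:
  "assoc_algebra (free_alg M :: ('k::field, gen_word \<Rightarrow>\<^sub>0 'k) module)"
proof -
  interpret ring "free_alg M :: ('k, gen_word \<Rightarrow>\<^sub>0 'k) module"
    by (rule ring_free_alg)
  show ?thesis
  proof (unfold_locales, goal_cases)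
    case (1 x c)
    then show ?case
      using free_alg_mult_closed[OF free_alg_const_closed[of c]] by (simp add: free_alg_def)
  next
    case (7 x y c)
    have "x * (Poly_Mapping.single 0 c * y) = Poly_Mapping.single 0 c * (x * y)"
      by (simp add: single_zero_commute[of x c] flip: mult.assoc)
    then show ?case by (simp add: free_alg_def)
  qed (simp_all add: free_alg_def single_add distrib_left distrib_right mult_single
        flip: mult.assoc)
qed

lemma quot_alg_simps:
  "carrier (quot_alg A I) = a_rcosets\<^bsub>A\<^esub> I"
  "monoid.mult (quot_alg A I) = rcoset_mult A I"
  "one (quot_alg A I) = I +>\<^bsub>A\<^esub> \<one>\<^bsub>A\<^esub>"
  "zero (quot_alg A I) = I"
  "add (quot_alg A I) = set_add A"
  "smult (quot_alg A I) = (\<lambda>c X. \<Union>x\<in>X. I +>\<^bsub>A\<^esub> (c \<odot>\<^bsub>A\<^esub> x))"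
  by (simp_all add: quot_alg_def FactRing_def ring.defs module.defs)

context assoc_algebra
begin

lemma ideal_smult_closed:
  assumes "ideal I A" "x \<in> I"
  shows "c \<odot> x \<in> I"
proof -
  interpret ideal I A by fact
  have x: "x \<in> carrier A" using assms(2) by (rule a_Hcarr)
  have "c \<odot> x = (c \<odot> \<one>) \<otimes> x" using x by (simp add: smult_mult_l)
  then show ?thesis using I_l_closed[OF assms(2) smult_closed[OF one_closed]] by simp
qed

lemma quot_alg_smult:
  assumes "ideal I A" "x \<in> carrier A"
  shows "c \<odot>\<^bsub>quot_alg A I\<^esub> (I +> x) = I +> (c \<odot> x)"
proof -
  interpret ideal I A by fact
  have eq: "I +> (c \<odot> y) = I +> (c \<odot> x)" if y: "y \<in> I +> x" for y
  proof -
    obtain h where h: "h \<in> I" "y = h \<oplus> x"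
      using y by (auto simp: a_r_coset_def')
    have hc: "h \<in> carrier A" using h(1) by (rule a_Hcarr)
    have "c \<odot> y = c \<odot> h \<oplus> c \<odot> x"
      using h hc assms(2) by (simp add: smult_r_distr)
    then have "c \<odot> y \<in> I +> (c \<odot> x)"
      using ideal_smult_closed[OF assms(1) h(1)] by (auto simp: a_r_coset_def')
    then show ?thesis
      using a_repr_independence[OF _ smult_closed[OF assms(2)]] a_subgroup by simp
  qed
  have "x \<in> I +> x" using assms(2) by (rule a_rcos_self)
  then have "(\<Union>y\<in>I +> x. I +> (c \<odot> y)) = I +> (c \<odot> x)"
    by (intro SUP_eq_const eq) blast
  then show ?thesis by (simp only: quot_alg_simps)
qed

lemma assoc_algebra_quot_alg:
  assumes "ideal I A"
  shows "assoc_algebra (quot_alg A I)"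
proof -
  interpret I: ideal I A by fact
  interpret Q: ring "A Quot I" by (rule I.quotient_is_ring)
  have eqs: "carrier (quot_alg A I) = carrier (A Quot I)"
    "monoid.mult (quot_alg A I) = monoid.mult (A Quot I)"
    "one (quot_alg A I) = one (A Quot I)"
    "zero (quot_alg A I) = zero (A Quot I)"
    "add (quot_alg A I) = add (A Quot I)"
    by (simp_all add: quot_alg_simps FactRing_def)
  interpret R: ring "quot_alg A I"
  proof (intro ringI abelian_groupI monoidI, unfold eqs)
    show "\<exists>y\<in>carrier (A Quot I). y \<oplus>\<^bsub>A Quot I\<^esub> x = \<zero>\<^bsub>A Quot I\<^esub>" if "x \<in> carrier (A Quot I)" for x
      using that by (intro bexI[of _ "\<ominus>\<^bsub>A Quot I\<^esub> x"]) (rule Q.l_neg Q.a_inv_closed; assumption)+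
  qed (fact Q.a_closed Q.a_assoc Q.a_comm Q.zero_closed Q.l_zero Q.m_closed Q.one_closed
      Q.m_assoc Q.l_one Q.r_one Q.l_distr Q.r_distr)+
  have coset: "\<exists>x\<in>carrier A. X = I +> x" if "X \<in> carrier (quot_alg A I)" for X
    using that by (auto simp: quot_alg_simps A_RCOSETS_def')
  have in_quot: "I +> x \<in> carrier (quot_alg A I)" if "x \<in> carrier A" for x
    using that by (auto simp: quot_alg_simps A_RCOSETS_def')
  have add: "(I +> x) \<oplus>\<^bsub>quot_alg A I\<^esub> (I +> y) = I +> (x \<oplus> y)"
    if "x \<in> carrier A" "y \<in> carrier A" for x y
    using I.a_rcos_sum[OF that] by (simp add: quot_alg_simps)
  have mult: "(I +> x) \<otimes>\<^bsub>quot_alg A I\<^esub> (I +> y) = I +> (x \<otimes> y)"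
    if "x \<in> carrier A" "y \<in> carrier A" for x y
    using I.rcoset_mult_add[OF that] by (simp add: quot_alg_simps)
  note sm = quot_alg_smult[OF assms]
  show ?thesis
  proof (unfold_locales, goal_cases)
    case (1 X c)
    then show ?case using coset by (fastforce simp: sm in_quot smult_closed)
  next
    case (2 X c d)
    then obtain x where "x \<in> carrier A" "X = I +> x" using coset by blast
    then show ?case by (simp add: sm add smult_closed smult_l_distr)
  next
    case (3 X Y c)
    then obtain x y where "x \<in> carrier A" "X = I +> x" "y \<in> carrier A" "Y = I +> y"
      using coset by metis
    then show ?case by (simp add: sm add smult_closed smult_r_distr)
  next
    case (4 X c d)
    then obtain x where "x \<in> carrier A" "X = I +> x" using coset by blast
    then show ?case by (simp add: sm smult_closed smult_assoc1)
  next
    case (5 X)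
    then obtain x where "x \<in> carrier A" "X = I +> x" using coset by blast
    then show ?case by (simp add: sm smult_one)
  next
    case (6 X Y c)
    then obtain x y where "x \<in> carrier A" "X = I +> x" "y \<in> carrier A" "Y = I +> y"
      using coset by metis
    then show ?case by (simp add: sm mult smult_closed smult_mult_l)
  next
    case (7 X Y c)
    then obtain x y where "x \<in> carrier A" "X = I +> x" "y \<in> carrier A" "Y = I +> y"
      using coset by metis
    then show ?case by (simp add: sm mult smult_closed smult_mult_r)
  qed
qed

end

lemma nTL_rels_subset:
  "(nTL_rels M :: (gen_word \<Rightarrow>\<^sub>0 'k::field) set) \<subseteq> carrier (free_alg M)"
proof -
  have diff: "p - q \<in> carrier (free_alg M)"
    if "p \<in> carrier (free_alg M)" "q \<in> carrier (free_alg M)" for p q :: "gen_word \<Rightarrow>\<^sub>0 'k"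
    using free_alg_add_closed[OF that(1) free_alg_uminus_closed[OF that(2)]] by simp
  note closed = diff free_alg_mult_closed fvar_in_free_alg
  show ?thesis
    unfolding nTL_rels_def by (auto intro!: closed)
qed

lemma ideal_nTL_ideal: "ideal (nTL_ideal M) (free_alg M)"
  unfolding nTL_ideal_def by (rule ring.genideal_ideal[OF ring_free_alg nTL_rels_subset])

lemma assoc_algebra_nTL: "assoc_algebra (nTL M)"
  unfolding nTL_def
  by (rule assoc_algebra.assoc_algebra_quot_alg[OF assoc_algebra_free_alg ideal_nTL_ideal])

lemma nTL_gen_closed: "i < M \<Longrightarrow> nTL_gen M i \<in> carrier (nTL M)"
  using fvar_in_free_alg[of i M] by (auto simp: nTL_def nTL_gen_def quot_alg_simps A_RCOSETS_def')

end

theory Submission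
  imports Defs
begin

text \<open>
  The algebra on \<open>M\<close> generators acts on configurations of particles on a cycle of \<open>M\<close> sites, at
  most one particle per site: the letter \<open>i\<close> moves a particle from site \<open>i + 1\<close> to the empty
  site \<open>i\<close>, and kills every configuration where this move is impossible; a word is executed from left
  to right. The defining relations respect this action: \<open>a\<^sub>i a\<^sub>i\<close>, \<open>a\<^sub>i a\<^sub>i\<^sub>+\<^sub>1 a\<^sub>i\<close> and
  \<open>a\<^sub>i\<^sub>+\<^sub>1 a\<^sub>i a\<^sub>i\<^sub>+\<^sub>1\<close> cannot be executed at all, and moves on two disjoint pairs of sites commute.

  When words are in addition graded by the multiset of their letters, the action determines the
  algebra. Firstly, a word that runs on no configuration is zero: if between two consecutive
  occurrences of a letter one of its two neighbours is missing, then the relations kill the word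
  (\<open>gap_in_I\<close>), and otherwise the first letters that touch each site prescribe a configuration on
  which the word runs (\<open>runs_if_adapted\<close>). Secondly, two words with the same letters that run on a
  common configuration are equal modulo commutations (\<open>word_diff_in_I_if_same_run\<close>). Hence an
  element of the free algebra lies in the ideal of relations iff, for each configuration \<open>c\<close> and
  multiset \<open>\<mu>\<close>, the coefficients of its words with letters \<open>\<mu>\<close> that run on \<open>c\<close> add up to
  zero (\<open>mem_I_iff\<close>).

  The substitution of the theorem is what the action does when an extra site is inserted between
  \<open>m\<close> and the site after it: with the new site \<open>m + 1\<close> empty, \<open>a\<^sub>m\<^sub>+\<^sub>1 a\<^sub>m\<close> carries a particle over
  it, as \<open>a\<^sub>m\<close> did before (\<open>runs_split_word\<close>). So the criterion for an element and the criterion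
  for its image amount to the same conditions (\<open>split_hom_mem_ideal_iff\<close>). One direction says that the
  homomorphism is well defined on the quotient, the other that it is injective.
\<close>

section \<open>Linear maps out of a free algebra\<close>

definition pairing :: "('a \<Rightarrow> 'k::comm_ring_1) \<Rightarrow> ('a \<Rightarrow>\<^sub>0 'k) \<Rightarrow> 'k"
  where "pairing f x = (\<Sum>w\<in>Poly_Mapping.keys x. Poly_Mapping.lookup x w * f w)"

definition linear_extension :: "('a \<Rightarrow> 'b) \<Rightarrow> ('a \<Rightarrow>\<^sub>0 'k::comm_ring_1) \<Rightarrow> ('b \<Rightarrow>\<^sub>0 'k)"
  where "linear_extension h x =
    (\<Sum>w\<in>Poly_Mapping.keys x. Poly_Mapping.single (h w) (Poly_Mapping.lookup x w))"

lemma poly_mapping_additive_induct [case_names single add]: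
  fixes x :: "'a \<Rightarrow>\<^sub>0 'k::comm_ring_1"
  assumes "\<And>w c. P (Poly_Mapping.single w c)" and "\<And>x y. P x \<Longrightarrow> P y \<Longrightarrow> P (x + y)"
  shows "P x"
proof (induction x rule: update_induct)
  case const
  show ?case using assms(1)[of undefined 0] by simp
next
  case (update p w d)
  have "Poly_Mapping.update w d p = p + Poly_Mapping.single w d"
    using update.hyps(1)
    by (intro poly_mapping_eqI)
      (auto simp: lookup_update lookup_add lookup_single in_keys_iff when_def)
  with update.IH show ?case
    by (simp add: assms)
qed

lemma pairing_zero [simp]: "pairing f 0 = 0"
  by (simp add: pairing_def)

lemma pairing_single [simp]: "pairing f (Poly_Mapping.single w c) = c * f w"
  by (cases "c = 0") (simp_all add: pairing_def)

lemma pairing_add [simp]: "pairing f (x + y) = pairing f x + pairing f y"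
  unfolding pairing_def by (rule setsum_keys_plus_distrib) (simp_all add: distrib_right)

lemma pairing_uminus [simp]: "pairing f (- x) = - pairing f x"
  using pairing_add[of f x "- x"] by (simp add: eq_neg_iff_add_eq_0 add.commute del: pairing_add)

lemma pairing_diff [simp]: "pairing f (x - y) = pairing f x - pairing f y"
  using pairing_add[of f x "- y"] by simp

lemma pairing_cong:
  "(\<And>w. w \<in> Poly_Mapping.keys x \<Longrightarrow> f w = g w) \<Longrightarrow> pairing f x = pairing g x"
  by (simp add: pairing_def)

lemma pairing_mult_left:
  fixes x y :: "'a::monoid_add \<Rightarrow>\<^sub>0 'k::comm_ring_1"
  shows "pairing f (y * x) = pairing (\<lambda>u. pairing (\<lambda>w. f (u + w)) x) y"
proof (induction y rule: poly_mapping_additive_induct)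
  case (single u c)
  show ?case
    by (induction x rule: poly_mapping_additive_induct)
      (simp_all add: mult_single distrib_left mult.assoc)
qed (simp add: distrib_right)

lemma pairing_mult_right:
  fixes x y :: "'a::monoid_add \<Rightarrow>\<^sub>0 'k::comm_ring_1"
  shows "pairing f (x * y) = pairing (\<lambda>v. pairing (\<lambda>w. f (w + v)) x) y"
proof (induction y rule: poly_mapping_additive_induct)
  case (single v c)
  show ?case
    by (induction x rule: poly_mapping_additive_induct)
      (simp_all add: mult_single distrib_left distrib_right algebra_simps)
qed (simp add: distrib_left)

lemma linear_extension_single [simp]:
  "linear_extension h (Poly_Mapping.single w c) = Poly_Mapping.single (h w) c"
  by (cases "c = 0") (simp_all add: linear_extension_def)

lemma linear_extension_add [simp]:
  "linear_extension h (x + y) = linear_extension h x + linear_extension h y"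
  unfolding linear_extension_def
  by (rule setsum_keys_plus_distrib[where f = "\<lambda>w. Poly_Mapping.single (h w)"])
    (simp_all add: single_add)

lemma linear_extension_mult:
  fixes h :: "'a::monoid_add \<Rightarrow> 'b::monoid_add"
  assumes "\<And>u v. h (u + v) = h u + h v"
  shows "linear_extension h (x * y) = linear_extension h x * linear_extension h y"
proof (induction x rule: poly_mapping_additive_induct)
  case (single u c)
  show ?case
    by (induction y rule: poly_mapping_additive_induct)
      (simp_all add: mult_single assms distrib_left)
qed (simp add: distrib_right)

lemma keys_linear_extension:
  "Poly_Mapping.keys (linear_extension h x) \<subseteq> h ` Poly_Mapping.keys x"
  unfolding linear_extension_def using keys_sum by (fastforce split: if_splits)

lemma pairing_linear_extension:
  "pairing f (linear_extension h x) = pairing (f \<circ> h) x"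
  by (induction x rule: poly_mapping_additive_induct) simp_all

text \<open>A space of common zeros is a priori only a subspace. But a functional on a product is a linear
  combination of translates of that functional on either factor, so closure under translations makes
  it a two-sided ideal.\<close>
lemma ideal_of_common_zeros:
  fixes F :: "(gen_word \<Rightarrow> 'k::field) set"
  assumes left: "\<And>f u. f \<in> F \<Longrightarrow> (\<lambda>w. f (u + w)) \<in> F"
    and right: "\<And>f v. f \<in> F \<Longrightarrow> (\<lambda>w. f (w + v)) \<in> F"
  shows "ideal {x \<in> carrier (free_alg M). \<forall>f\<in>F. pairing f x = 0} (free_alg M)" (is "ideal ?Z _")
proof (rule idealI[OF ring_free_alg])
  interpret ring "free_alg M :: ('k, gen_word \<Rightarrow>\<^sub>0 'k) module"
    by (rule ring_free_alg)
  have minus: "\<ominus>\<^bsub>free_alg M\<^esub> x = - x" if "x \<in> carrier (free_alg M)" for x :: "gen_word \<Rightarrow>\<^sub>0 'k"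
    by (rule minus_equality) (use that in \<open>auto simp: free_alg_def\<close>)
  show "subgroup ?Z (add_monoid (free_alg M))"
  proof (rule add.subgroupI)
    show "?Z \<noteq> {}"
      by (auto simp: free_alg_def intro!: exI[of _ 0])
  next
    fix x :: "gen_word \<Rightarrow>\<^sub>0 'k" assume "x \<in> ?Z"
    then show "\<ominus>\<^bsub>free_alg M\<^esub> x \<in> ?Z"
      using free_alg_uminus_closed[of x M] by (simp add: minus)
  next
    fix x y :: "gen_word \<Rightarrow>\<^sub>0 'k" assume "x \<in> ?Z" "y \<in> ?Z"
    then show "x \<oplus>\<^bsub>free_alg M\<^esub> y \<in> ?Z"
      using free_alg_add_closed[of x M y] by (simp add: free_alg_def)
  qed auto
  fix x y :: "gen_word \<Rightarrow>\<^sub>0 'k" assume xy: "x \<in> ?Z" "y \<in> carrier (free_alg M)"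
  have "pairing f (y * x) = 0" if "f \<in> F" for f
    using xy left[OF that] by (simp add: pairing_mult_left) (simp add: pairing_def)
  moreover have "pairing f (x * y) = 0" if "f \<in> F" for f
    using xy right[OF that] by (simp add: pairing_mult_right) (simp add: pairing_def)
  ultimately show "y \<otimes>\<^bsub>free_alg M\<^esub> x \<in> ?Z" "x \<otimes>\<^bsub>free_alg M\<^esub> y \<in> ?Z"
    using xy free_alg_mult_closed[of x M y] free_alg_mult_closed[of y M x]
    by (simp_all add: free_alg_def)
qed

section \<open>Particle configurations on a cycle\<close>

definition next_site :: "nat \<Rightarrow> nat \<Rightarrow> nat"
  where "next_site M i = (i + 1) mod M"

definition prev_site :: "nat \<Rightarrow> nat \<Rightarrow> nat"
  where "prev_site M i = (i + M - 1) mod M"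

lemma next_site_eq: "i < M \<Longrightarrow> next_site M i = (if i + 1 = M then 0 else i + 1)"
  by (simp add: next_site_def)

lemma prev_site_eq: "i < M \<Longrightarrow> prev_site M i = (if i = 0 then M - 1 else i - 1)"
  by (auto simp: prev_site_def mod_if)

lemma next_site_less [simp]: "i < M \<Longrightarrow> next_site M i < M"
  and prev_site_less [simp]: "i < M \<Longrightarrow> prev_site M i < M"
  by (auto simp: next_site_eq prev_site_eq)

lemma next_prev_site [simp]: "i < M \<Longrightarrow> next_site M (prev_site M i) = i"
  and prev_next_site [simp]: "i < M \<Longrightarrow> prev_site M (next_site M i) = i"
  by (auto simp: next_site_eq prev_site_eq)

lemma next_site_neq:
  "3 \<le> M \<Longrightarrow> i < M \<Longrightarrow> next_site M i \<noteq> i"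
  "3 \<le> M \<Longrightarrow> i < M \<Longrightarrow> prev_site M i \<noteq> i"
  "3 \<le> M \<Longrightarrow> i < M \<Longrightarrow> next_site M i \<noteq> prev_site M i"
  by (auto simp: next_site_eq prev_site_eq split: if_splits)

text \<open>A configuration is the set of its occupied sites, and \<open>run\<close> is the configuration that a word
  leaves behind; it is meaningful only where \<open>runs\<close> holds.\<close>
fun runs :: "nat \<Rightarrow> nat set \<Rightarrow> nat list \<Rightarrow> bool"
  where "runs M c [] = True"
  | "runs M c (i # w) =
      (next_site M i \<in> c \<and> i \<notin> c \<and> runs M (insert i (c - {next_site M i})) w)"

fun run :: "nat \<Rightarrow> nat set \<Rightarrow> nat list \<Rightarrow> nat set"
  where "run M c [] = c"
  | "run M c (i # w) = run M (insert i (c - {next_site M i})) w"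

lemma runs_append: "runs M c (u @ v) \<longleftrightarrow> runs M c u \<and> runs M (run M c u) v"
  by (induction u arbitrary: c) auto

lemma cong_diff_iff_next_site:
  assumes "i < M" "j < M" "3 \<le> M"
  shows "[int i - int j = 1] (mod int M) \<longleftrightarrow> i = next_site M j"
    and "[int i - int j = - 1] (mod int M) \<longleftrightarrow> j = next_site M i"
proof -
  have eq: "[int i - int j = 1] (mod int M) \<longleftrightarrow> i = next_site M j" if "i < M" "j < M" for i j
  proof -
    have "[int i - int j = 1] (mod int M) \<longleftrightarrow> [int i = int (j + 1)] (mod int M)"
      by (simp add: cong_iff_dvd_diff algebra_simps)
    also have "\<dots> \<longleftrightarrow> i = next_site M j"
      using that by (simp only: cong_int_iff) (simp add: next_site_def cong_def)
    finally show ?thesis .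
  qed
  show "[int i - int j = 1] (mod int M) \<longleftrightarrow> i = next_site M j"
    using assms by (simp add: eq)
  have "[int i - int j = - 1] (mod int M) \<longleftrightarrow> [int j - int i = 1] (mod int M)"
    using cong_minus_minus_iff[of "int j - int i" 1 "int M"] by simp
  then show "[int i - int j = - 1] (mod int M) \<longleftrightarrow> j = next_site M i"
    using assms by (simp add: eq)
qed

section \<open>Relations act by zero\<close>

definition word_poly :: "nat list \<Rightarrow> (gen_word \<Rightarrow>\<^sub>0 'k::comm_ring_1)"
  where "word_poly w = Poly_Mapping.single (Word w) 1"

lemma word_poly_append: "word_poly (u @ v) = word_poly u * word_poly v"
  by (simp add: word_poly_def mult_single plus_gen_word_def)

lemma fvar_eq_word_poly: "fvar i = word_poly [i]"
  by (simp add: fvar_def word_poly_def)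

lemma fvar_mult_eq_word_poly: "fvar i * fvar j = word_poly [i, j]"
  by (simp add: fvar_eq_word_poly flip: word_poly_append)

lemma fvar_mult3_eq_word_poly: "fvar i * fvar j * fvar k = word_poly [i, j, k]"
  by (simp add: fvar_eq_word_poly flip: word_poly_append)

lemma word_poly_in_free_alg: "set w \<subseteq> {..<M} \<Longrightarrow> word_poly w \<in> carrier (free_alg M)"
  by (simp add: free_alg_def word_poly_def)

text \<open>The multiset of letters accounts for turns around the cycle: a word that carries a single
  particle once around restores its configuration, just as the empty word does.\<close>
definition run_indicator :: "nat \<Rightarrow> nat set \<Rightarrow> nat multiset \<Rightarrow> gen_word \<Rightarrow> 'k::comm_ring_1"
  where "run_indicator M c \<mu> w = of_bool (runs M c (letters w) \<and> mset (letters w) = \<mu>)"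

text \<open>The ideal is a parameter so that the field \<open>'k\<close> of coefficients is determined by it.\<close>
locale nTL_presentation =
  fixes M :: nat and I :: "(gen_word \<Rightarrow>\<^sub>0 'k::field) set"
  assumes three_le: "3 \<le> M" and I_eq: "I = nTL_ideal M"
begin

lemma I_ideal: "ideal I (free_alg M)"
  by (simp add: I_eq ideal_nTL_ideal)

lemma I_subset: "I \<subseteq> carrier (free_alg M)"
  using I_ideal by (auto dest: ideal.Icarr)

lemma zero_in_I: "0 \<in> I"
  using additive_subgroup.zero_closed[OF ideal.axioms(1)[OF I_ideal]] by (simp add: free_alg_def)

lemma I_mult_left: "x \<in> I \<Longrightarrow> y \<in> carrier (free_alg M) \<Longrightarrow> y * x \<in> I"
  using ideal.I_l_closed[OF I_ideal, of x y] by (simp add: free_alg_def)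

lemma I_mult_right: "x \<in> I \<Longrightarrow> y \<in> carrier (free_alg M) \<Longrightarrow> x * y \<in> I"
  using ideal.I_r_closed[OF I_ideal, of x y] by (simp add: free_alg_def)

lemma I_add: "x \<in> I \<Longrightarrow> y \<in> I \<Longrightarrow> x + y \<in> I"
  using additive_subgroup.a_closed[OF ideal.axioms(1)[OF I_ideal], of x y]
  by (simp add: free_alg_def)

lemma I_diff: "x \<in> I \<Longrightarrow> y \<in> I \<Longrightarrow> x - y \<in> I"
  using I_add[of x "Poly_Mapping.single 0 (- 1) * y"]
    I_mult_left[OF _ free_alg_const_closed[of "- 1"], of y]
  by (simp add: single_uminus)

lemma rels_in_I: "nTL_rels M \<subseteq> I"
  unfolding I_eq nTL_ideal_def by (rule ring.genideal_self[OF ring_free_alg nTL_rels_subset])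

lemma I_sandwich:
  "x \<in> I \<Longrightarrow> set p \<subseteq> {..<M} \<Longrightarrow> set q \<subseteq> {..<M} \<Longrightarrow> word_poly p * x * word_poly q \<in> I"
  by (intro I_mult_left I_mult_right word_poly_in_free_alg)

lemma word_in_I_context:
  "word_poly w \<in> I \<Longrightarrow> set p \<subseteq> {..<M} \<Longrightarrow> set q \<subseteq> {..<M} \<Longrightarrow> word_poly (p @ w @ q) \<in> I"
  using I_sandwich[of "word_poly w" p q] by (simp add: word_poly_append mult.assoc)

lemma word_diff_in_I_context:
  "word_poly w - word_poly w' \<in> I \<Longrightarrow> set p \<subseteq> {..<M} \<Longrightarrow> set q \<subseteq> {..<M} \<Longrightarrow>
    word_poly (p @ w @ q) - word_poly (p @ w' @ q) \<in> I"
  using I_sandwich[of "word_poly w - word_poly w'" p q]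
  by (simp add: word_poly_append mult.assoc algebra_simps)

lemma word_in_I_cong:
  "word_poly w - word_poly w' \<in> I \<Longrightarrow> word_poly w' \<in> I \<Longrightarrow> word_poly w \<in> I"
  using I_add[of "word_poly w - word_poly w'" "word_poly w'"] by simp

lemma word_diff_in_I_trans:
  "word_poly u - word_poly v \<in> I \<Longrightarrow> word_poly v - word_poly w \<in> I \<Longrightarrow>
    word_poly u - word_poly w \<in> I"
  using I_add[of "word_poly u - word_poly v" "word_poly v - word_poly w"] by simp

lemma word_diff_in_I_sym:
  "word_poly u - word_poly v \<in> I \<Longrightarrow> word_poly v - word_poly u \<in> I"
  using I_diff[OF zero_in_I, of "word_poly u - word_poly v"] by simp

lemma square_in_I: "i < M \<Longrightarrow> word_poly [i, i] \<in> I"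
  using rels_in_I by (auto simp: nTL_rels_def fvar_mult_eq_word_poly)

lemma braid_in_I:
  assumes "i < M"
  shows "word_poly [i, next_site M i, i] \<in> I" "word_poly [next_site M i, i, next_site M i] \<in> I"
  using rels_in_I assms
  by (auto simp: nTL_rels_def fvar_mult3_eq_word_poly next_site_def simp del: One_nat_def)

lemma commutator_in_I:
  assumes "i < M" "j < M" "i \<noteq> next_site M j" "j \<noteq> next_site M i"
  shows "word_poly [i, j] - word_poly [j, i] \<in> I"
proof -
  have "fvar i * fvar j - fvar j * fvar i \<in> (nTL_rels M :: (gen_word \<Rightarrow>\<^sub>0 'k) set)"
    using assms three_le unfolding nTL_rels_def
    by (simp only: Un_iff mem_Collect_eq) (metis cong_diff_iff_next_site)
  then show ?thesis
    using rels_in_I by (auto simp: fvar_mult_eq_word_poly)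
qed

lemma commute_past:
  assumes "i < M" "set u \<subseteq> {..<M}" "\<And>k. k \<in> set u \<Longrightarrow> k \<noteq> next_site M i \<and> i \<noteq> next_site M k"
  shows "word_poly (u @ [i]) - word_poly (i # u) \<in> I"
  using assms(2,3)
proof (induction u)
  case Nil
  show ?case by (simp add: zero_in_I)
next
  case (Cons k u)
  have "word_poly ([k] @ (u @ [i]) @ []) - word_poly ([k] @ (i # u) @ []) \<in> I"
    using Cons by (intro word_diff_in_I_context) auto
  moreover have "word_poly ([] @ [k, i] @ u) - word_poly ([] @ [i, k] @ u) \<in> I"
    using Cons.prems assms(1) by (intro word_diff_in_I_context commutator_in_I) auto
  ultimately show ?case
    using word_diff_in_I_trans[of "k # u @ [i]" "k # i # u" "i # k # u"] by simp
qed

lemma runs_square: "\<not> runs M c (u @ [i, i] @ v)"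
  by (simp add: runs_append)

lemma runs_braid:
  assumes "i < M"
  shows "\<not> runs M c (u @ [i, next_site M i, i] @ v)"
    and "\<not> runs M c (u @ [next_site M i, i, next_site M i] @ v)"
proof -
  have "next_site M (next_site M i) \<noteq> i"
    using next_site_neq(3)[OF three_le, of "next_site M i"] assms by simp
  then show "\<not> runs M c (u @ [i, next_site M i, i] @ v)"
    "\<not> runs M c (u @ [next_site M i, i, next_site M i] @ v)"
    by (auto simp: runs_append)
qed

lemma runs_commute:
  assumes "i < M" "j < M" "i \<noteq> next_site M j" "j \<noteq> next_site M i"
  shows "runs M c (u @ [i, j] @ v) \<longleftrightarrow> runs M c (u @ [j, i] @ v)"
proof (cases "i = j")
  case False
  then have ne: "next_site M i \<noteq> next_site M j"
    using assms by (metis prev_next_site)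
  have "insert j (insert i (d - {next_site M i}) - {next_site M j}) =
      insert i (insert j (d - {next_site M j}) - {next_site M i})" for d
    using assms by auto
  then show ?thesis
    using assms False ne by (auto simp: runs_append)
qed simp

text \<open>The indicator itself is not closed under translation, so the proof works with the indicators
  of \<open>p w q\<close> for all surrounding words \<open>p\<close> and \<open>q\<close>.\<close>
lemma pairing_run_indicator_eq_0:
  assumes "x \<in> I"
  shows "pairing (run_indicator M c \<mu>) x = 0"
proof -
  define f where "f = (\<lambda>c p q \<mu> w.
    of_bool (runs M c (p @ letters w @ q) \<and> mset (p @ letters w @ q) = \<mu>) :: 'k)"
  define F where "F = {f c p q \<mu> | c p q \<mu>. True}"
  have "ideal {x \<in> carrier (free_alg M). \<forall>f\<in>F. pairing f x = 0} (free_alg M)"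
  proof (rule ideal_of_common_zeros)
    fix g u assume "g \<in> F"
    then obtain c p q \<mu> where "g = f c p q \<mu>" by (auto simp: F_def)
    then have "(\<lambda>w. g (u + w)) = f c (p @ letters u) q \<mu>" "(\<lambda>w. g (w + u)) = f c p (letters u @ q) \<mu>"
      by (auto simp: f_def add.assoc)
    then show "(\<lambda>w. g (u + w)) \<in> F" "(\<lambda>w. g (w + u)) \<in> F"
      by (auto simp: F_def)
  qed
  moreover have "pairing (f c p q \<mu>) r = 0" if "r \<in> nTL_rels M" for r c p q \<mu>
    using that unfolding nTL_rels_def
  proof (elim UnE CollectE exE conjE)
    fix i j
    assume "r = fvar i * fvar j - fvar j * fvar i" "i < M" "j < M"
      "\<not> [int i - int j = 1] (mod int M)" "\<not> [int i - int j = - 1] (mod int M)"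
    then have "i \<noteq> next_site M j" "j \<noteq> next_site M i"
      using cong_diff_iff_next_site three_le by auto
    with \<open>r = _\<close> \<open>i < M\<close> \<open>j < M\<close> show ?thesis
      using runs_commute[of i j c p q]
      by (simp add: fvar_mult_eq_word_poly word_poly_def f_def add_mset_commute)
  next
    fix i assume "r = fvar i * fvar i"
    then show ?thesis
      using runs_square[of c p i q] by (simp add: fvar_mult_eq_word_poly word_poly_def f_def)
  next
    fix i assume "r = fvar i * fvar ((i + 1) mod M) * fvar i" "i < M"
    then show ?thesis
      using runs_braid(1)[of i c p q]
      by (simp add: fvar_mult3_eq_word_poly word_poly_def f_def next_site_def)
  next
    fix i assume "r = fvar ((i + 1) mod M) * fvar i * fvar ((i + 1) mod M)" "i < M"
    then show ?thesis
      using runs_braid(2)[of i c p q]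
      by (simp add: fvar_mult3_eq_word_poly word_poly_def f_def next_site_def)
  qed
  then have "nTL_rels M \<subseteq> {x \<in> carrier (free_alg M). \<forall>f\<in>F. pairing f x = 0}"
    by (auto simp: F_def dest: subsetD[OF nTL_rels_subset])
  ultimately have "I \<subseteq> {x \<in> carrier (free_alg M). \<forall>f\<in>F. pairing f x = 0}"
    unfolding I_eq nTL_ideal_def by (rule ring.genideal_minimal[OF ring_free_alg])
  moreover have "run_indicator M c \<mu> = f c [] [] \<mu>"
    by (simp add: run_indicator_def f_def fun_eq_iff)
  then have "run_indicator M c \<mu> \<in> F"
    unfolding F_def by blast
  ultimately show ?thesis
    using assms by blast
qed

section \<open>The action determines the ideal\<close>

text \<open>The neighbour \<open>s i\<close> is missing between two occurrences of \<open>i\<close>, so only the other neighbour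
  \<open>t i\<close> can keep them apart. If \<open>t i\<close> occurs at most once there, commutations bring the word to a
  defining relation. If it occurs twice, then between its first two occurrences its own neighbour
  \<open>i = s (t i)\<close> is missing, and the same situation has arisen on a shorter stretch.\<close>
lemma gap_in_I:
  assumes adj: "(s, t) \<in> {(next_site M, prev_site M), (prev_site M, next_site M)}"
  assumes "i < M" "set v \<subseteq> {..<M}" "i \<notin> set v" "s i \<notin> set v"
  shows "word_poly (i # v @ [i]) \<in> I"
  using assms(2-)
proof (induction "length v" arbitrary: i v rule: less_induct)
  case less
  have t: "t i < M" "s (t i) = i" "t i \<noteq> i"
    using adj less.prems(1) next_site_neq[OF three_le] by auto
  have iti: "word_poly [i, t i, i] \<in> I"
    using adj braid_in_I[of i] braid_in_I[of "prev_site M i"] less.prems(1) by auto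
  have far: "k \<noteq> next_site M i \<and> i \<noteq> next_site M k" if "k < M" "k \<noteq> s i" "k \<noteq> t i" for k
    using adj that by auto
  show ?case
  proof (cases "t i \<in> set v")
    case False
    have "word_poly ([i] @ (v @ [i]) @ []) - word_poly ([i] @ (i # v) @ []) \<in> I"
      using less.prems False by (intro word_diff_in_I_context commute_past far) auto
    moreover have "word_poly ([] @ [i, i] @ v) \<in> I"
      using less.prems by (intro word_in_I_context square_in_I) auto
    ultimately show ?thesis
      using word_in_I_cong[of "i # v @ [i]" "i # i # v"] by simp
  next
    case True
    then obtain v1 v2 where v: "v = v1 @ t i # v2" "t i \<notin> set v1"
      by (meson split_list_first)
    show ?thesis
    proof (cases "t i \<in> set v2")
      case False
      have "word_poly ([] @ (v1 @ [i]) @ (t i # v2 @ [i])) -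
          word_poly ([] @ (i # v1) @ (t i # v2 @ [i])) \<in> I"
        using less.prems v by (intro word_diff_in_I_context commute_past far) auto
      moreover have "word_poly ((v1 @ [i, t i]) @ (v2 @ [i]) @ []) -
          word_poly ((v1 @ [i, t i]) @ (i # v2) @ []) \<in> I"
        using less.prems v False t by (intro word_diff_in_I_context commute_past far) auto
      moreover have "word_poly (v1 @ [i, t i, i] @ v2) \<in> I"
        using less.prems v iti by (intro word_in_I_context) auto
      ultimately show ?thesis
        using word_in_I_cong[of "v1 @ [i, t i] @ v2 @ [i]" "v1 @ [i, t i, i] @ v2"]
          word_in_I_cong[of "i # v @ [i]" "v1 @ [i, t i] @ v2 @ [i]"] v(1)
        by (auto dest: word_diff_in_I_sym)
    next
      case True
      then obtain v3 v4 where v2: "v2 = v3 @ t i # v4" "t i \<notin> set v3"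
        by (meson split_list_first)
      have "word_poly (t i # v3 @ [t i]) \<in> I"
        using less.prems v(1) v2 t by (intro less.hyps) auto
      then have "word_poly ((i # v1) @ (t i # v3 @ [t i]) @ (v4 @ [i])) \<in> I"
        using less.prems v(1) v2 by (intro word_in_I_context) auto
      then show ?thesis
        by (simp add: v(1) v2(1))
    qed
  qed
qed

lemma gap_in_I_left:
  assumes "i < M" "set v \<subseteq> {..<M}" "i \<notin> set v" "next_site M i \<notin> set v"
  shows "word_poly (i # v @ [i]) \<in> I"
  using assms by (intro gap_in_I[of "next_site M" "prev_site M"]) auto

lemma gap_in_I_right:
  assumes "i < M" "set v \<subseteq> {..<M}" "i \<notin> set v" "prev_site M i \<notin> set v"
  shows "word_poly (i # v @ [i]) \<in> I"
  using assms by (intro gap_in_I[of "prev_site M" "next_site M"]) auto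

text \<open>Site \<open>s\<close> is affected only by the letters \<open>s\<close>, which fills it, and \<open>s - 1\<close>, which empties
  it. So the first of these in a word dictates whether \<open>s\<close> has to be occupied at the start.\<close>
definition adapted :: "nat set \<Rightarrow> nat list \<Rightarrow> bool"
  where "adapted c w \<longleftrightarrow> (\<forall>s<M. case find (\<lambda>k. k = s \<or> k = prev_site M s) w of
    None \<Rightarrow> True | Some k \<Rightarrow> s \<in> c \<longleftrightarrow> k = prev_site M s)"

lemma exists_adapted: "\<exists>c. adapted c w"
  by (rule exI[of _ "{s. find (\<lambda>k. k = s \<or> k = prev_site M s) w = Some (prev_site M s)}"])
    (auto simp: adapted_def split: option.splits)

text \<open>Running the first letter \<open>i\<close> keeps the configuration adapted to the rest of the word: at the two
  sites that it changes, the next relevant letter cannot again be \<open>i\<close>, because one of the neighbours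
  of \<open>i\<close> would be missing in between.\<close>
lemma runs_if_adapted:
  assumes "set w \<subseteq> {..<M}" "adapted c w" "word_poly w \<notin> I"
  shows "runs M c w"
  using assms
proof (induction w arbitrary: c)
  case (Cons i w)
  have i: "i < M" and w: "set w \<subseteq> {..<M}"
    using Cons.prems(1) by auto
  note adj = next_site_less[OF i] prev_site_less[OF i] next_prev_site[OF i] prev_next_site[OF i]
    next_site_neq[OF three_le i]
  let ?c = "insert i (c - {next_site M i})"
  have no_gap: "word_poly (i # v @ [i]) \<notin> I" if "w = v @ i # v'" for v v'
    using word_in_I_context[of "i # v @ [i]" "[]" v'] Cons.prems that by auto
  have first: "\<exists>v v'. w = v @ k # v' \<and> (\<forall>x\<in>set v. \<not> P x) \<and> P k" if "find P w = Some k" for P k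
    using that by (auto simp: find_Some_iff) (metis Cons_nth_drop_Suc id_take_nth_drop in_set_conv_nth
        length_take less_trans min.absorb4 nth_take)
  have "next_site M i \<in> c"
    using Cons.prems(2) adj unfolding adapted_def by (auto dest!: spec[of _ "next_site M i"])
  moreover have "i \<notin> c"
    using Cons.prems(2) adj i unfolding adapted_def by (auto dest!: spec[of _ i])
  moreover have "runs M ?c w"
  proof (rule Cons.IH[OF w])
    show "word_poly w \<notin> I"
      using word_in_I_context[of w "[i]" "[]"] Cons.prems by auto
    show "adapted ?c w"
      unfolding adapted_def
    proof (intro allI impI)
      fix s assume s: "s < M"
      let ?P = "\<lambda>k. k = s \<or> k = prev_site M s"
      show "case find ?P w of None \<Rightarrow> True | Some k \<Rightarrow> s \<in> ?c \<longleftrightarrow> k = prev_site M s"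
      proof (cases "find ?P w")
        case (Some k)
        then obtain v v' where v: "w = v @ k # v'" "\<forall>x\<in>set v. \<not> ?P x" "?P k"
          using first by blast
        consider "s = i" | "s = next_site M i" | "s \<noteq> i" "prev_site M s \<noteq> i"
          using s by (metis next_prev_site)
        then have "s \<in> ?c \<longleftrightarrow> k = prev_site M s"
        proof cases
          case 1
          have "k \<noteq> i"
            using no_gap[of v v'] gap_in_I_right[of i v] v w i 1 by auto
          then show ?thesis
            using 1 v by auto
        next
          case 2
          have "k \<noteq> i"
            using no_gap[of v v'] gap_in_I_left[of i v] v w i 2 adj by auto
          then show ?thesis
            using 2 v adj by auto
        next
          case 3
          then have "s \<noteq> next_site M i"
            using adj by auto
          then show ?thesis
            using Cons.prems(2) 3 Some s unfolding adapted_def by (auto dest!: spec[of _ s])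
        qed
        then show ?thesis by (simp add: Some)
      qed simp
    qed
  qed
  ultimately show ?case by simp
qed simp

lemma exists_run:
  assumes "set w \<subseteq> {..<M}" "word_poly w \<notin> I"
  shows "\<exists>c. runs M c w"
  using assms runs_if_adapted exists_adapted by blast

text \<open>The letters that touch a site alternate between filling and emptying it, so a word that starts
  on an occupied site and never empties it does not fill it either; dually for an empty site.\<close>
lemma filling_letter_absent:
  assumes "runs M c (u @ v)" "s \<in> c" "set u \<subseteq> {..<M}" "s < M" "prev_site M s \<notin> set u"
  shows "s \<notin> set u"
  using assms
proof (induction u arbitrary: c)
  case (Cons k u)
  have "s \<in> insert k (c - {next_site M k})"
    using Cons.prems by auto
  with Cons show ?case by auto
qed simp

lemma emptying_letter_absent:
  assumes "runs M c (u @ v)" "s \<notin> c" "set u \<subseteq> {..<M}" "s < M" "s \<notin> set u"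
  shows "prev_site M s \<notin> set u"
  using assms
proof (induction u arbitrary: c)
  case (Cons k u)
  have "s \<notin> insert k (c - {next_site M k})"
    using Cons.prems by auto
  with Cons show ?case by auto
qed simp

text \<open>If \<open>i # w\<close> runs on \<open>c\<close>, then \<open>i + 1\<close> is occupied and \<open>i\<close> empty in \<open>c\<close>. In another word
  that runs on \<open>c\<close>, no neighbour of \<open>i\<close> can precede the first \<open>i\<close>: the letter \<open>i + 1\<close> would fill
  an occupied site and \<open>i - 1\<close> would empty an empty one. So this \<open>i\<close> commutes to the front.\<close>
lemma word_diff_in_I_if_same_run:
  assumes "runs M c w" "runs M c w'" "mset w = mset w'" "set w \<subseteq> {..<M}"
  shows "word_poly w - word_poly w' \<in> I"
  using assms
proof (induction w arbitrary: c w')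
  case Nil
  then show ?case by (simp add: zero_in_I)
next
  case (Cons i w)
  have set_w': "set w' \<subseteq> {..<M}"
    using Cons.prems by (metis mset_eq_setD)
  have "i \<in> set w'"
    using Cons.prems by (metis list.set_intros(1) mset_eq_setD)
  then obtain u v where w': "w' = u @ i # v" "i \<notin> set u"
    by (meson split_list_first)
  have i: "i < M" and set_uv: "set u \<subseteq> {..<M}" "set v \<subseteq> {..<M}" "set w \<subseteq> {..<M}"
    using Cons.prems set_w' w' by auto
  have "next_site M i \<notin> set u"
    using filling_letter_absent[of c u "i # v" "next_site M i"] Cons.prems w' set_uv i by auto
  moreover have "prev_site M i \<notin> set u"
    using emptying_letter_absent[of c u "i # v" i] Cons.prems w' set_uv i by auto
  ultimately have far: "k \<noteq> next_site M i \<and> i \<noteq> next_site M k" if "k \<in> set u" for k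
    using that set_uv by auto
  have "word_poly ([] @ (u @ [i]) @ v) - word_poly ([] @ (i # u) @ v) \<in> I"
    using far set_uv i by (intro word_diff_in_I_context commute_past) auto
  then have pull: "word_poly w' - word_poly (i # u @ v) \<in> I"
    by (simp add: w')
  have "(run_indicator M c (mset w') (Word w') :: 'k) = run_indicator M c (mset w') (Word (i # u @ v))"
    using pairing_run_indicator_eq_0[OF pull, of c "mset w'"] by (simp add: word_poly_def)
  then have "runs M c (i # u @ v)"
    using Cons.prems(2) w' by (simp add: run_indicator_def split: if_splits)
  then have "word_poly w - word_poly (u @ v) \<in> I"
    using Cons.prems w' set_uv by (intro Cons.IH[of "insert i (c - {next_site M i})"]) auto
  then have "word_poly ([i] @ w @ []) - word_poly ([i] @ (u @ v) @ []) \<in> I"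
    using i by (intro word_diff_in_I_context) auto
  with pull show ?case
    by (auto intro: word_diff_in_I_trans dest: word_diff_in_I_sym)
qed

text \<open>For the converse, terms are removed from \<open>x\<close> one at a time. A word outside the ideal runs on
  some \<open>c\<close>, and since the coefficients of the words with the same letters that run on \<open>c\<close> cancel,
  there is another such word in \<open>x\<close>. It is congruent to the first and can absorb its coefficient.\<close>
theorem mem_I_iff:
  "x \<in> I \<longleftrightarrow> x \<in> carrier (free_alg M) \<and> (\<forall>c \<mu>. pairing (run_indicator M c \<mu>) x = 0)"
proof
  assume "x \<in> I"
  then show "x \<in> carrier (free_alg M) \<and> (\<forall>c \<mu>. pairing (run_indicator M c \<mu>) x = 0)"
    using I_subset pairing_run_indicator_eq_0 by blast
next
  assume "x \<in> carrier (free_alg M) \<and> (\<forall>c \<mu>. pairing (run_indicator M c \<mu>) x = 0)"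
  then show "x \<in> I"
  proof (induction "card (Poly_Mapping.keys x)" arbitrary: x rule: less_induct)
    case less
    show ?case
    proof (cases "Poly_Mapping.keys x = {}")
      case True
      then have "x = 0"
        by (intro poly_mapping_eqI) (auto simp: in_keys_iff)
      then show ?thesis by (simp add: zero_in_I)
    next
      case False
      then obtain W where "W \<in> Poly_Mapping.keys x" by blast
      moreover obtain w where W: "W = Word w" by (cases W)
      ultimately have w: "Word w \<in> Poly_Mapping.keys x" by simp
      have letters: "set (letters v) \<subseteq> {..<M}" if "v \<in> Poly_Mapping.keys x" for v
        using less.prems that by (auto simp: free_alg_def)
      define a where "a = Poly_Mapping.lookup x (Word w)"
      have "a \<noteq> 0" using w by (simp add: a_def in_keys_iff)
      have "\<exists>y\<in>I. Poly_Mapping.lookup y (Word w) = 1 \<and> Poly_Mapping.keys y \<subseteq> Poly_Mapping.keys x"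
      proof (cases "word_poly w \<in> I")
        case True
        then show ?thesis
          using w by (intro bexI[of _ "word_poly w"]) (auto simp: word_poly_def)
      next
        case False
        then obtain c where c: "runs M c w"
          using exists_run letters[OF w] by auto
        have "\<exists>v\<in>Poly_Mapping.keys x. v \<noteq> Word w \<and> run_indicator M c (mset w) v \<noteq> 0"
        proof (rule ccontr)
          assume "\<not> ?thesis"
          then have "pairing (run_indicator M c (mset w)) x =
              (\<Sum>v\<in>Poly_Mapping.keys x. if v = Word w then a else 0)"
            using c unfolding pairing_def
            by (intro sum.cong) (auto simp: run_indicator_def a_def)
          also have "\<dots> = a" using w by (simp add: sum.delta)
          finally show False using less.prems \<open>a \<noteq> 0\<close> by simp
        qed
        then obtain v where v: "v \<in> Poly_Mapping.keys x" "v \<noteq> Word w" "runs M c (letters v)"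
            "mset (letters v) = mset w"
          by (auto simp: run_indicator_def)
        have "word_poly w - word_poly (letters v) \<in> I"
          using c v letters[OF w] by (intro word_diff_in_I_if_same_run) auto
        moreover have "Poly_Mapping.keys (word_poly w - word_poly (letters v) :: gen_word \<Rightarrow>\<^sub>0 'k)
            \<subseteq> {Word w, v}"
          by (auto simp: word_poly_def in_keys_iff lookup_minus lookup_single when_def split: if_splits)
        ultimately show ?thesis
          using v w
          by (intro bexI[of _ "word_poly w - word_poly (letters v)"])
            (auto simp: word_poly_def lookup_minus lookup_single when_def)
      qed
      then obtain y where y: "y \<in> I" "Poly_Mapping.lookup y (Word w) = 1"
          "Poly_Mapping.keys y \<subseteq> Poly_Mapping.keys x"
        by blast
      \<comment> \<open>Subtracting this multiple of \<open>y\<close> removes the word \<open>w\<close> and introduces no new one.\<close>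
      define z where "z = Poly_Mapping.single 0 a * y"
      have z: "z \<in> I"
        unfolding z_def by (intro I_mult_left y free_alg_const_closed)
      have lookup_z: "Poly_Mapping.lookup z v = a * Poly_Mapping.lookup y v" for v
        unfolding z_def mult_map_scale_conv_mult[symmetric] by (simp add: map.rep_eq when_def)
      have "Poly_Mapping.lookup y v = 0" if "Poly_Mapping.lookup x v = 0" for v
        using y(3) that by (auto simp: in_keys_iff)
      then have "Poly_Mapping.keys (x - z) \<subseteq> Poly_Mapping.keys x - {Word w}"
        using y(2) by (auto simp: in_keys_iff lookup_minus lookup_z a_def)
      then have "card (Poly_Mapping.keys (x - z)) < card (Poly_Mapping.keys x)"
        using w by (metis card_Diff1_less card_mono finite_Diff finite_keys le_less_trans)
      moreover have "x - z \<in> carrier (free_alg M)"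
        using free_alg_add_closed[of x M "- z"] free_alg_uminus_closed[of z M] less.prems z I_subset
        by auto
      ultimately have "x - z \<in> I"
        using less.prems pairing_run_indicator_eq_0[OF z] by (intro less.hyps) auto
      then show ?thesis
        using I_add[OF _ z] by fastforce
    qed
  qed
qed

end

section \<open>Inserting an empty site\<close>

text \<open>The sites of the smaller cycle are all sites of the larger one except \<open>m + 1\<close>.\<close>
definition shift_site :: "nat \<Rightarrow> nat \<Rightarrow> nat"
  where "shift_site m s = (if s \<le> m then s else s + 1)"

definition split_letter :: "nat \<Rightarrow> nat \<Rightarrow> nat list"
  where "split_letter m i = (if i = m then [m + 1, m] else [shift_site m i])"

definition split_word :: "nat \<Rightarrow> gen_word \<Rightarrow> gen_word"
  where "split_word m w = Word (concat (map (split_letter m) (letters w)))"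

lemma inj_shift_site: "inj (shift_site m)"
  by (auto simp: inj_def shift_site_def split: if_splits)

lemma shift_site_neq [simp]: "shift_site m s \<noteq> Suc m" "Suc m \<noteq> shift_site m s"
  by (auto simp: shift_site_def)

lemma shift_site_self [simp]: "shift_site m m = m"
  by (simp add: shift_site_def)

lemma shift_site_eq_self_iff [simp]: "shift_site m s = m \<longleftrightarrow> s = m" "m = shift_site m s \<longleftrightarrow> s = m"
  by (auto simp: shift_site_def)

lemma shift_site_eq_iff [simp]: "shift_site m s = shift_site m t \<longleftrightarrow> s = t"
  using inj_shift_site by (auto simp: inj_eq)

lemma next_site_shift_site:
  assumes "i < N" "m < N" "i \<noteq> m"
  shows "next_site (N + 1) (shift_site m i) = shift_site m (next_site N i)"
  using assms by (auto simp: next_site_eq shift_site_def)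

lemma next_site_split:
  assumes "m < N"
  shows "next_site (N + 1) m = m + 1"
    and "next_site (N + 1) (m + 1) = shift_site m (next_site N m)"
  using assms by (auto simp: next_site_eq shift_site_def)

text \<open>A particle sitting on the new site blocks every image of the letter \<open>m\<close>, since these begin with
  the letter \<open>m + 1\<close> and nothing else can remove the particle; otherwise the new site does not
  interfere.\<close>
lemma runs_split_word:
  assumes "3 \<le> N" "m < N" "set w \<subseteq> {..<N}"
  shows "runs (N + 1) c (concat (map (split_letter m) w)) \<longleftrightarrow>
    runs N (shift_site m -` c) w \<and> (m + 1 \<in> c \<longrightarrow> m \<notin> set w)"
  using assms(3)
proof (induction w arbitrary: c)
  case (Cons i w)
  have i: "i < N" and w: "set w \<subseteq> {..<N}"
    using Cons.prems by auto
  note IH = Cons.IH[OF w]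
  show ?case
  proof (cases "i = m")
    case False
    let ?c = "insert (shift_site m i) (c - {shift_site m (next_site N i)})"
    have c: "shift_site m -` ?c = insert i (shift_site m -` c - {next_site N i})"
      by auto
    have "runs (N + 1) c (concat (map (split_letter m) (i # w))) \<longleftrightarrow>
        shift_site m (next_site N i) \<in> c \<and> shift_site m i \<notin> c \<and>
        runs (N + 1) ?c (concat (map (split_letter m) w))"
      using False next_site_shift_site[OF i assms(2) False] by (simp add: split_letter_def)
    also have "\<dots> \<longleftrightarrow> runs N (shift_site m -` c) (i # w) \<and> (m + 1 \<in> c \<longrightarrow> m \<notin> set (i # w))"
      unfolding IH c using False by auto
    finally show ?thesis .
  next
    case True
    let ?c = "insert (m + 1) (c - {shift_site m (next_site N m)})"
    have c: "shift_site m -` insert m (?c - {m + 1}) = insert m (shift_site m -` c - {next_site N m})"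
      by (auto simp: shift_site_def split: if_splits)
    have "m \<noteq> shift_site m (next_site N m)"
      using next_site_neq(1)[OF assms(1,2)] by simp
    then have "runs (N + 1) c (concat (map (split_letter m) (i # w))) \<longleftrightarrow>
        shift_site m (next_site N m) \<in> c \<and> m + 1 \<notin> c \<and> m \<notin> c \<and>
        runs (N + 1) (insert m (?c - {m + 1})) (concat (map (split_letter m) w))"
      using True next_site_split[OF assms(2)] by (simp add: split_letter_def)
    also have "\<dots> \<longleftrightarrow> runs N (shift_site m -` c) (i # w) \<and> (m + 1 \<in> c \<longrightarrow> m \<notin> set (i # w))"
      unfolding IH c using True by auto
    finally show ?thesis .
  qed
qed simp

lemma count_split_word:
  "count (mset (concat (map (split_letter m) w))) (shift_site m i) = count (mset w) i"
  by (induction w) (auto simp: split_letter_def)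

lemma mset_split_word_eq_iff:
  "mset (concat (map (split_letter m) u)) = mset (concat (map (split_letter m) v)) \<longleftrightarrow>
    mset u = mset v"
proof
  assume "mset (concat (map (split_letter m) u)) = mset (concat (map (split_letter m) v))"
  then have "count (mset u) i = count (mset v) i" for i
    using count_split_word[of m u i] count_split_word[of m v i] by simp
  then show "mset u = mset v"
    by (rule multiset_eqI)
next
  assume "mset u = mset v"
  then have "(\<Sum>i\<in>#mset u. mset (split_letter m i)) = (\<Sum>i\<in>#mset v. mset (split_letter m i))"
    by simp
  moreover have "(\<Sum>i\<in>#mset w. mset (split_letter m i)) = mset (concat (map (split_letter m) w))" for w
    by (induction w) auto
  ultimately show "mset (concat (map (split_letter m) u)) = mset (concat (map (split_letter m) v))"
    by simp
qed

lemma split_word_add: "split_word m (u + v) = split_word m u + split_word m v"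
  by (simp add: split_word_def plus_gen_word_def)

lemma split_word_zero [simp]: "split_word m 0 = 0"
  by (simp add: split_word_def zero_gen_word_def)

definition split_hom :: "nat \<Rightarrow> (gen_word \<Rightarrow>\<^sub>0 'k::field) \<Rightarrow> (gen_word \<Rightarrow>\<^sub>0 'k)"
  where "split_hom m = linear_extension (split_word m)"

lemma split_hom_closed:
  assumes "m < N" "x \<in> carrier (free_alg N)"
  shows "split_hom m x \<in> carrier (free_alg (N + 1))"
proof -
  have "set (letters (split_word m w)) \<subseteq> {..<N + 1}" if "set (letters w) \<subseteq> {..<N}" for w
    using that assms(1) by (auto simp: split_word_def split_letter_def shift_site_def split: if_splits)
  then show ?thesis
    using assms(2) keys_linear_extension[of "split_word m" x]
    by (fastforce simp: free_alg_def split_hom_def)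
qed

lemma split_hom_ring_hom:
  assumes "m < N"
  shows "split_hom m \<in> ring_hom (free_alg N) (free_alg (N + 1))"
proof (rule ring_hom_memI)
  show "split_hom m x \<in> carrier (free_alg (N + 1))" if "x \<in> carrier (free_alg N)" for x
    using assms that by (rule split_hom_closed)
  show "split_hom m \<one>\<^bsub>free_alg N\<^esub> = \<one>\<^bsub>free_alg (N + 1)\<^esub>"
    by (simp add: free_alg_def split_hom_def flip: single_one)
qed (simp_all add: free_alg_def split_hom_def linear_extension_mult split_word_add)

text \<open>Each functional of the criterion on the larger cycle pulls back to one on the smaller cycle or
  to zero, and each on the smaller cycle arises in this way, from a configuration whose new site is
  empty.\<close>
lemma split_hom_mem_ideal_iff:
  fixes x :: "gen_word \<Rightarrow>\<^sub>0 'k::field"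
  assumes "3 \<le> N" "m < N" "x \<in> carrier (free_alg N)"
  shows "split_hom m x \<in> nTL_ideal (N + 1) \<longleftrightarrow> x \<in> nTL_ideal N"
proof -
  interpret A: nTL_presentation N "nTL_ideal N :: (gen_word \<Rightarrow>\<^sub>0 'k) set"
    using assms by unfold_locales auto
  interpret B: nTL_presentation "N + 1" "nTL_ideal (N + 1) :: (gen_word \<Rightarrow>\<^sub>0 'k) set"
    using assms by unfold_locales auto
  let ?split = "\<lambda>w. concat (map (split_letter m) w)"
  have letters: "set (letters w) \<subseteq> {..<N}" if "w \<in> Poly_Mapping.keys x" for w
    using assms(3) that by (auto simp: free_alg_def)
  have pull: "pairing (run_indicator (N + 1) c \<mu>) (split_hom m x) =
      pairing (\<lambda>w. of_bool (runs N (shift_site m -` c) (letters w) \<and>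
        (m + 1 \<in> c \<longrightarrow> m \<notin> set (letters w)) \<and> mset (?split (letters w)) = \<mu>)) x" for c \<mu>
    unfolding split_hom_def pairing_linear_extension
    using runs_split_word[OF assms(1,2) letters]
    by (intro pairing_cong) (simp add: run_indicator_def split_word_def)
  show ?thesis
  proof
    assume *: "split_hom m x \<in> nTL_ideal (N + 1)"
    have "pairing (run_indicator N c \<mu>) x = 0" for c \<mu>
    proof -
      obtain v where v: "\<mu> = mset v" by (metis ex_mset)
      have "shift_site m -` shift_site m ` c = c"
        by (simp add: inj_shift_site inj_vimage_image_eq)
      moreover have "m + 1 \<notin> shift_site m ` c" by auto
      ultimately have "pairing (run_indicator N c \<mu>) x =
          pairing (run_indicator (N + 1) (shift_site m ` c) (mset (?split v))) (split_hom m x)"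
        unfolding pull
        by (intro pairing_cong) (auto simp: run_indicator_def v mset_split_word_eq_iff)
      then show ?thesis
        using B.pairing_run_indicator_eq_0[OF *] by simp
    qed
    then show "x \<in> nTL_ideal N"
      unfolding A.mem_I_iff using assms(3) by blast
  next
    assume *: "x \<in> nTL_ideal N"
    have "pairing (run_indicator (N + 1) c \<mu>) (split_hom m x) = 0" for c \<mu>
      \<comment> \<open>If no word with the letters \<open>\<mu>\<close> in its image can run, the functional pulls back to zero.
        Otherwise one such word \<open>v\<close> supplies both the multiset to use on the smaller cycle and, if the
        new site is occupied, the absence of \<open>m\<close> from all words with these letters.\<close>
    proof (cases "\<exists>v. (m + 1 \<in> c \<longrightarrow> m \<notin> set v) \<and> mset (?split v) = \<mu>")
      case True
      then obtain v where v: "m + 1 \<in> c \<longrightarrow> m \<notin> set v" "mset (?split v) = \<mu>" by blast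
      have "pairing (run_indicator (N + 1) c \<mu>) (split_hom m x) =
          pairing (run_indicator N (shift_site m -` c) (mset v)) x"
        unfolding pull using v mset_split_word_eq_iff[of m _ v]
        by (intro pairing_cong) (auto simp: run_indicator_def dest: mset_eq_setD)
      then show ?thesis
        using A.pairing_run_indicator_eq_0[OF *] by simp
    next
      case False
      then have "pairing (run_indicator (N + 1) c \<mu>) (split_hom m x) = pairing (\<lambda>_. 0) x"
        unfolding pull by (intro pairing_cong) auto
      then show ?thesis by (simp add: pairing_def)
    qed
    then show "split_hom m x \<in> nTL_ideal (N + 1)"
      unfolding B.mem_I_iff using split_hom_closed[OF assms(2,3)] by blast
  qed
qed

section \<open>Passing to the quotients\<close>

text \<open>The first isomorphism theorem for algebras, without the description of the image.\<close>
lemma quotient_alg_hom: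
  assumes A: "assoc_algebra A" and B: "assoc_algebra B" and h: "h \<in> alg_hom A B"
    and I: "I = a_kernel A B h"
  defines "\<phi> \<equiv> \<lambda>X. the_elem (h ` X)"
  shows "\<phi> \<in> alg_hom (quot_alg A I) B" "inj_on \<phi> (carrier (quot_alg A I))"
    "x \<in> carrier A \<Longrightarrow> \<phi> (I +>\<^bsub>A\<^esub> x) = h x"
proof -
  interpret A: assoc_algebra A by fact
  interpret B: assoc_algebra B by fact
  have hom: "h \<in> ring_hom A B" and lin: "\<And>c x. x \<in> carrier A \<Longrightarrow> h (c \<odot>\<^bsub>A\<^esub> x) = c \<odot>\<^bsub>B\<^esub> h x"
    using h by (auto simp: alg_hom_def)
  interpret ring_hom_ring A B h
    by (rule ring_hom_ringI2[OF A.ring_axioms B.ring_axioms hom])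
  have carrier: "carrier (quot_alg A I) = carrier (A Quot I)"
    by (simp add: quot_alg_simps FactRing_def)
  show coset: "\<phi> (I +>\<^bsub>A\<^esub> x) = h x" if "x \<in> carrier A" for x
    using that by (simp add: \<phi>_def I)
  have "\<phi> \<in> ring_hom (quot_alg A I) B"
    using the_elem_hom unfolding ring_hom_def \<phi>_def I
    by (simp add: quot_alg_simps FactRing_def)
  moreover have "\<phi> (c \<odot>\<^bsub>quot_alg A I\<^esub> X) = c \<odot>\<^bsub>B\<^esub> \<phi> X" if "X \<in> carrier (quot_alg A I)" for c X
  proof -
    obtain x where x: "x \<in> carrier A" "X = I +>\<^bsub>A\<^esub> x"
      using \<open>X \<in> carrier (quot_alg A I)\<close> by (auto simp: quot_alg_simps A_RCOSETS_def')
    then show ?thesis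
      using A.quot_alg_smult[of I x c] kernel_is_ideal A.smult_closed[of x c]
      by (simp add: coset lin flip: I)
  qed
  ultimately show "\<phi> \<in> alg_hom (quot_alg A I) B"
    by (simp add: alg_hom_def)
  show "inj_on \<phi> (carrier (quot_alg A I))"
    using the_elem_inj unfolding inj_on_def carrier \<phi>_def by (simp add: I)
qed

theorem theorem7p1:
  fixes N m :: nat
  assumes "3 \<le> N" and "m \<le> N - 1"
  shows "\<exists>\<epsilon> \<in> alg_hom (nTL N :: ('k::field, _) module) (nTL (N + 1)).
           inj_on \<epsilon> (carrier (nTL N)) \<and>
           (\<forall>i<N. \<epsilon> (nTL_gen N i) =
              (if i < m then nTL_gen (N + 1) i
               else if i = m then nTL_gen (N + 1) (m + 1) \<otimes>\<^bsub>nTL (N + 1)\<^esub> nTL_gen (N + 1) m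
               else nTL_gen (N + 1) (i + 1)))"
proof -
  have m: "m < N" using assms by linarith
  let ?A = "free_alg N :: ('k, _) module" and ?B = "free_alg (N + 1) :: ('k, _) module"
  let ?I = "nTL_ideal N :: (gen_word \<Rightarrow>\<^sub>0 'k) set"
  let ?J = "nTL_ideal (N + 1) :: (gen_word \<Rightarrow>\<^sub>0 'k) set"
  interpret B: assoc_algebra ?B by (rule assoc_algebra_free_alg)
  interpret J: ideal ?J ?B by (rule ideal_nTL_ideal)
  define h where "h = (\<lambda>x. ?J +>\<^bsub>?B\<^esub> split_hom m x)"
  have "h \<in> ring_hom ?A (nTL (N + 1))"
  proof -
    have "(\<lambda>x. ?J +>\<^bsub>?B\<^esub> x) \<circ> split_hom m \<in> ring_hom ?A (?B Quot ?J)"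
      by (rule ring_hom_trans[OF split_hom_ring_hom[OF m] J.rcos_ring_hom])
    then show ?thesis
      by (simp add: ring_hom_def h_def nTL_def quot_alg_simps FactRing_def o_def)
  qed
  moreover have "h (c \<odot>\<^bsub>?A\<^esub> x) = c \<odot>\<^bsub>nTL (N + 1)\<^esub> h x" if "x \<in> carrier ?A" for c x
  proof -
    have "split_hom m (c \<odot>\<^bsub>?A\<^esub> x) = c \<odot>\<^bsub>?B\<^esub> split_hom m x"
      by (simp add: free_alg_def split_hom_def linear_extension_mult split_word_add)
    then show ?thesis
      using B.quot_alg_smult[OF ideal_nTL_ideal split_hom_closed[OF m that]]
      by (simp add: h_def nTL_def)
  qed
  ultimately have h: "h \<in> alg_hom ?A (nTL (N + 1))"
    by (simp add: alg_hom_def)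
  have "h x = ?J \<longleftrightarrow> x \<in> ?I" if "x \<in> carrier ?A" for x
    using split_hom_mem_ideal_iff[OF assms(1) m that] split_hom_closed[OF m that]
      J.a_rcos_const J.a_rcos_self[of "split_hom m x"]
    by (auto simp: h_def)
  then have "?I = a_kernel ?A (nTL (N + 1)) h"
    using ideal.Icarr[OF ideal_nTL_ideal]
    by (auto simp: a_kernel_def' nTL_def quot_alg_simps)
  note \<epsilon> = quotient_alg_hom[OF assoc_algebra_free_alg assoc_algebra_nTL h this]
  have gen: "the_elem (h ` nTL_gen N i) =
      (if i < m then nTL_gen (N + 1) i
       else if i = m then nTL_gen (N + 1) (m + 1) \<otimes>\<^bsub>nTL (N + 1)\<^esub> nTL_gen (N + 1) m
       else nTL_gen (N + 1) (i + 1))" if "i < N" for i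
  proof -
    have "nTL_gen (N + 1) (m + 1) \<otimes>\<^bsub>nTL (N + 1)\<^esub> nTL_gen (N + 1) m =
        ?J +>\<^bsub>?B\<^esub> (fvar (m + 1) * fvar m)"
      using J.rcoset_mult_add[OF fvar_in_free_alg[of "m + 1"] fvar_in_free_alg[of m]] m
      by (simp add: nTL_gen_def nTL_def quot_alg_simps) (simp add: free_alg_def)
    moreover have "split_hom m (fvar i :: gen_word \<Rightarrow>\<^sub>0 'k) =
        (if i < m then fvar i else if i = m then fvar (m + 1) * fvar m else fvar (i + 1))"
      by (simp add: split_hom_def fvar_def split_word_def split_letter_def shift_site_def
          mult_single plus_gen_word_def)
    ultimately show ?thesis
      using \<epsilon>(3)[OF fvar_in_free_alg[OF that]] by (simp add: nTL_gen_def h_def)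
  qed
  show ?thesis
    by (intro bexI[of _ "\<lambda>X. the_elem (h ` X)"] conjI allI impI gen)
      (use \<epsilon>(1,2) in \<open>simp_all flip: nTL_def\<close>)
qed

end
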